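(* Any proof labeling scheme for $\textsc{Circle-Recognition}$, and (for every fixed $k$) any proof labeling scheme for $k\textsc{-Polygon-Circle-Recognition}$, must use certificates of size $\Omega(\log n)$ bits on $n$-node networks.
   Context: A circle graph is the intersection graph of a family of chords of a circle; a $k$-polygon-circle graph is the intersection graph of a family of convex polygons with $k$ vertices, all vertices on a common circle. $\textsc{Circle-Recognition}$ (resp. $k\textsc{-Polygon-Circle-Recognition}$) is the set of configurations $\langle G,\mathrm{id}\rangle$ with $G$ a circle (resp. $k$-polygon-circle) graph. Distributed setting: $G$ is a simple connected $n$-node graph, nodes have unique identifiers in $\{1,\dots,\mathrm{poly}(n)\}$. A proof labeling scheme: an untrusted prover assigns each node a certificate; in one deterministic round each node sees its own id and certificate and those of its neighbors, and accepts or rejects; on yes-instances some assignment makes all nodes accept, on no-instances every assignment makes some node reject. Its size is the maximum certificate length. *)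

theory Defs
  imports "HOL-Analysis.Analysis"
begin

text \<open>Graphs: vertex set {0..<n}, adjacency relation E (symmetric, irreflexive,
  supported on the vertex set).\<close>

definition simple_graph :: "nat \<Rightarrow> (nat \<Rightarrow> nat \<Rightarrow> bool) \<Rightarrow> bool" where
  "simple_graph n E \<longleftrightarrow>
     (\<forall>u v. E u v \<longrightarrow> u < n \<and> v < n \<and> u \<noteq> v \<and> E v u)"

definition connected_graph :: "nat \<Rightarrow> (nat \<Rightarrow> nat \<Rightarrow> bool) \<Rightarrow> bool" where
  "connected_graph n E \<longleftrightarrow>
     (\<forall>u v. u < n \<longrightarrow> v < n \<longrightarrow> (u, v) \<in> {(x, y). E x y}\<^sup>*)"

text \<open>Circle graphs: intersection graphs of chords of the unit circle.\<close>

definition circle_graph :: "nat \<Rightarrow> (nat \<Rightarrow> nat \<Rightarrow> bool) \<Rightarrow> bool" where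
  "circle_graph n E \<longleftrightarrow>
     (\<exists>a b :: nat \<Rightarrow> complex.
        (\<forall>i<n. norm (a i) = 1 \<and> norm (b i) = 1 \<and> a i \<noteq> b i) \<and>
        (\<forall>i<n. \<forall>j<n. i \<noteq> j \<longrightarrow>
            (E i j \<longleftrightarrow> closed_segment (a i) (b i) \<inter> closed_segment (a j) (b j) \<noteq> {})))"

text \<open>k-polygon-circle graphs: intersection graphs of convex polygons with k vertices,
  all vertices on the unit circle (the polygon is the convex hull of its k vertices).\<close>

definition polygon_circle_graph :: "nat \<Rightarrow> nat \<Rightarrow> (nat \<Rightarrow> nat \<Rightarrow> bool) \<Rightarrow> bool" where
  "polygon_circle_graph k n E \<longleftrightarrow>
     (\<exists>S :: nat \<Rightarrow> complex set.
        (\<forall>i<n. finite (S i) \<and> card (S i) = k \<and> (\<forall>z\<in>S i. norm z = 1)) \<and>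
        (\<forall>i<n. \<forall>j<n. i \<noteq> j \<longrightarrow>
            (E i j \<longleftrightarrow> convex hull (S i) \<inter> convex hull (S j) \<noteq> {})))"

text \<open>Proof labeling schemes. A verifier A sees its own identifier, its own certificate
  and the set of (identifier, certificate) pairs of its neighbours. Identifiers are
  injective with values in {1..n^c}. A is a proof labeling scheme of size f for property
  P if on yes-instances some assignment of certificates of length at most f n makes all
  nodes accept, and on no-instances every assignment makes some node reject.\<close>

type_synonym verifier = "nat \<Rightarrow> bool list \<Rightarrow> (nat \<times> bool list) set \<Rightarrow> bool"

definition accepts_at :: "verifier \<Rightarrow> (nat \<Rightarrow> nat \<Rightarrow> bool) \<Rightarrow> (nat \<Rightarrow> nat)
    \<Rightarrow> (nat \<Rightarrow> bool list) \<Rightarrow> nat \<Rightarrow> bool" where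
  "accepts_at A E ident cert v \<longleftrightarrow> A (ident v) (cert v) {(ident u, cert u) | u. E v u}"

definition valid_ids :: "nat \<Rightarrow> nat \<Rightarrow> (nat \<Rightarrow> nat) \<Rightarrow> bool" where
  "valid_ids c n ident \<longleftrightarrow> inj_on ident {..<n} \<and> ident ` {..<n} \<subseteq> {1..n ^ c}"

definition is_pls :: "nat \<Rightarrow> (nat \<Rightarrow> (nat \<Rightarrow> nat \<Rightarrow> bool) \<Rightarrow> bool) \<Rightarrow> verifier
    \<Rightarrow> (nat \<Rightarrow> nat) \<Rightarrow> bool" where
  "is_pls c P A f \<longleftrightarrow>
     (\<forall>n E ident. n \<ge> 1 \<longrightarrow> simple_graph n E \<longrightarrow> connected_graph n E \<longrightarrow> valid_ids c n ident \<longrightarrow>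
        (P n E \<longrightarrow> (\<exists>cert. (\<forall>v<n. length (cert v) \<le> f n) \<and> (\<forall>v<n. accepts_at A E ident cert v))) \<and>
        (\<not> P n E \<longrightarrow> (\<forall>cert. \<exists>v<n. \<not> accepts_at A E ident cert v)))"

end

theory Submission
  imports Defs
begin

text \<open>The proof is a fooling-set argument. Take a ladder whose two side paths visit the rungs
  \<open>a\<^sub>i\<close> in the orders given by permutations \<open>p\<close> and \<open>q\<close>. For \<open>p = q\<close> it is a circle graph: draw the
  rungs as parallel chords and the side paths along the two remaining arcs. Conversely, in any
  representation by inscribed polygons the two side paths occupy disjoint arcs, the rungs are
  ordered from left to right between them, and both paths must follow this order up to reversal;
  since both permutations fix the rung 0 as the first one, this forces \<open>p = q\<close>.

  There are \<open>(w - 1)!\<close> such permutations. If a scheme with few bits gave the \<open>2w\<close> vertices of the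
  rungs and of one side path the same certificates for two different permutations \<open>p\<close> and \<open>q\<close>, then
  every node of the mixed ladder would see what it sees in one of the two yes-instances, and the
  mixed ladder would be accepted. Hence \<open>(w - 1)! \<le> 2 ^ (2w (f n + 1))\<close>, where \<open>w\<close> is about \<open>n / 3\<close>.
  Identifiers play no role: they are the same in all instances.\<close>

section \<open>Inscribed polygons\<close>

text \<open>Stereographic coordinates turn the cyclic order on the circle minus a point into the order of
  the reals, so chords cross iff their endpoints interleave.\<close>

definition stereo :: "real \<Rightarrow> complex" where
  "stereo x = Complex ((1 - x\<^sup>2) / (1 + x\<^sup>2)) (2 * x / (1 + x\<^sup>2))"

lemma one_plus_square_pos: "0 < 1 + (x::real)\<^sup>2"
  by (simp add: add_pos_nonneg)

lemma norm_stereo [simp]: "norm (stereo x) = 1"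
proof -
  have "(1 - x\<^sup>2)\<^sup>2 + (2 * x)\<^sup>2 = (1 + x\<^sup>2)\<^sup>2" by algebra
  then have "((1 - x\<^sup>2) / (1 + x\<^sup>2))\<^sup>2 + (2 * x / (1 + x\<^sup>2))\<^sup>2 = 1"
    using one_plus_square_pos[of x]
    by (simp add: power_divide add_divide_distrib[symmetric])
  then show ?thesis by (simp add: stereo_def norm_complex_def)
qed

lemma stereo_surj:
  assumes "norm z = 1" "z \<noteq> -1"
  obtains x where "stereo x = z"
proof -
  define a b where "a = Re z" and "b = Im z"
  have ab: "a\<^sup>2 + b\<^sup>2 = 1"
    using assms(1) by (simp add: a_def b_def norm_complex_def)
  have "a \<noteq> -1"
  proof
    assume "a = -1"
    with ab have "b = 0" by simp
    with \<open>a = -1\<close> assms(2) show False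
      by (simp add: a_def b_def complex_eq_iff)
  qed
  then have a: "1 + a \<noteq> 0" by linarith
  \<comment> \<open>The preimage of \<open>z\<close> will be \<open>b / (1 + a)\<close>, the slope
    of the line through -1 and \<open>z\<close>.\<close>
  have "(1 + a)\<^sup>2 + b\<^sup>2 = 2 * (1 + a)" using ab by (simp add: power2_eq_square algebra_simps)
  then have "((1 + a)\<^sup>2 + b\<^sup>2) / (1 + a)\<^sup>2 = 2 / (1 + a)"
    using a by (simp add: power2_eq_square del: distrib_left_numeral)
  then have 1: "1 + (b / (1 + a))\<^sup>2 = 2 / (1 + a)"
    using a by (simp add: power_divide add_divide_distrib)
  have 2: "1 - (b / (1 + a))\<^sup>2 = 2 * a / (1 + a)"
    using 1 a by (simp add: field_simps)
  have "stereo (b / (1 + a)) = Complex a b"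
    unfolding stereo_def 1 2 using a by simp
  then show ?thesis using that by (simp add: a_def b_def)
qed

text \<open>Twice the signed area of the triangle \<open>a\<close>, \<open>b\<close>,
  \<open>z\<close>: the sign tells on which side of the line through \<open>a\<close> and
  \<open>b\<close> the point \<open>z\<close> lies.\<close>

definition orient :: "complex \<Rightarrow> complex \<Rightarrow> complex \<Rightarrow> real" where
  "orient a b z = Im (cnj (b - a) * (z - a))"

text \<open>The numerator is a Vandermonde product and the denominator is positive, so the side of a
  chord is decided by the order of the parameters alone.\<close>

lemma orient_stereo:
  "orient (stereo x) (stereo y) (stereo z) =
     4 * (y - x) * (z - x) * (z - y) / ((1 + x\<^sup>2) * (1 + y\<^sup>2) * (1 + z\<^sup>2))"
proof -
  define X Y Z where "X = 1 + x\<^sup>2" and "Y = 1 + y\<^sup>2" and "Z = 1 + z\<^sup>2"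
  have nz: "X \<noteq> 0" "Y \<noteq> 0" "Z \<noteq> 0"
    using one_plus_square_pos by (auto simp: X_def Y_def Z_def less_le)
  have "((1-y\<^sup>2) / Y - (1-x\<^sup>2) / X) * (2*z / Z - 2*x / X)
       - (2*y / Y - 2*x / X) * ((1-z\<^sup>2) / Z - (1-x\<^sup>2) / X)
      = (((1-y\<^sup>2) * X - (1-x\<^sup>2) * Y) * (2*z * X - 2*x * Z)
       - (2*y * X - 2*x * Y) * ((1-z\<^sup>2) * X - (1-x\<^sup>2) * Z)) / (X * X * Y * Z)"
    using nz by (simp add: field_simps)
  also have "((1-y\<^sup>2) * X - (1-x\<^sup>2) * Y) * (2*z * X - 2*x * Z)
       - (2*y * X - 2*x * Y) * ((1-z\<^sup>2) * X - (1-x\<^sup>2) * Z) = X * (4 * (y - x) * (z - x) * (z - y))"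
    unfolding X_def Y_def Z_def by algebra
  also have "X * (4 * (y - x) * (z - x) * (z - y)) / (X * X * Y * Z) = 4 * (y - x) * (z - x) * (z - y) / (X * Y * Z)"
    using nz by simp
  finally show ?thesis
    by (simp add: orient_def stereo_def X_def Y_def Z_def algebra_simps)
qed

lemma orient_stereo_pos_iff:
  assumes "x < y"
  shows "orient (stereo x) (stereo y) (stereo z) > 0 \<longleftrightarrow> z < x \<or> y < z"
  using assms one_plus_square_pos[of x] one_plus_square_pos[of y] one_plus_square_pos[of z]
  by (auto simp: orient_stereo zero_less_divide_iff zero_less_mult_iff mult_less_0_iff)

text \<open>A common image of two parameters would give, together with a third point, a degenerate
  triangle of positive area.\<close>

lemma inj_stereo: "inj stereo"
proof (rule injI, rule ccontr)
  fix x y assume eq: "stereo x = stereo y" and "x \<noteq> y"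
  then have "orient (stereo (min x y)) (stereo (max x y)) (stereo (max x y + 1)) > 0"
    by (subst orient_stereo_pos_iff) auto
  moreover have "stereo (min x y) = stereo (max x y)" using eq by (simp add: min_def max_def)
  ultimately show False by (simp add: orient_def)
qed

lemma linear_orient_diff: "linear (\<lambda>z. Im (cnj (b - a) * z))"
  by (rule linearI) (simp_all add: algebra_simps)

lemma convex_orient_pos: "convex {z. orient a b z > 0}"
proof -
  have "{z. orient a b z > 0} = (\<lambda>z. Im (cnj (b - a) * z)) -` {Im (cnj (b - a) * a)<..}"
    by (auto simp: orient_def algebra_simps)
  then show ?thesis
    by (simp only:) (rule convex_linear_vimage[OF linear_orient_diff], simp)
qed

lemma convex_orient_nonpos: "convex {z. \<not> orient a b z > 0}"
proof -
  have "{z. \<not> orient a b z > 0} = (\<lambda>z. Im (cnj (b - a) * z)) -` {..Im (cnj (b - a) * a)}"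
    by (auto simp: orient_def algebra_simps)
  then show ?thesis
    by (simp only:) (rule convex_linear_vimage[OF linear_orient_diff], simp)
qed

definition inscribed :: "real set \<Rightarrow> complex set" where
  "inscribed X = convex hull (stereo ` X)"

text \<open>The line through \<open>stereo x\<close> and \<open>stereo y\<close> separates: one hull
  lies in the closed half plane, the other in the complementary open one.\<close>

lemma inscribed_disjoint:
  assumes "x < y" "X \<subseteq> {x..y}" "Y \<inter> {x..y} = {}"
  shows "inscribed X \<inter> inscribed Y = {}"
proof -
  let ?o = "orient (stereo x) (stereo y)"
  have "inscribed X \<subseteq> {z. \<not> ?o z > 0}" unfolding inscribed_def
    using assms by (intro hull_minimal convex_orient_nonpos) (auto simp: orient_stereo_pos_iff)
  moreover have "inscribed Y \<subseteq> {z. ?o z > 0}" unfolding inscribed_def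
    using assms by (intro hull_minimal convex_orient_pos) (fastforce simp: orient_stereo_pos_iff)
  ultimately show ?thesis by blast
qed

text \<open>On the line, \<open>z = a + s (b - a)\<close>, and the squared norm of \<open>z\<close>
  is \<open>1 - s (1 - s)\<close> times the squared length of the chord. Lying in the disc thus
  forces \<open>s\<close> into [0, 1].\<close>

lemma orient_zero_in_segment:
  assumes "norm a = 1" "norm b = 1" "a \<noteq> b" "orient a b z = 0" "norm z \<le> 1"
  shows "z \<in> closed_segment a b"
proof -
  define s where "s = Re ((z - a) / (b - a))"
  have "Im ((z - a) / (b - a)) = 0"
    using assms(4) by (simp add: complex_div_cnj[of "z - a"] orient_def mult.commute)
  then have "(z - a) / (b - a) = of_real s"
    by (simp add: complex_eq_iff s_def)
  then have z: "z = a + of_real s * (b - a)"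
    using assms(3) by (simp add: field_simps)
  have n: "(norm w)\<^sup>2 = w \<bullet> w" for w :: complex by (simp add: power2_norm_eq_inner)
  have aa: "a \<bullet> a = 1" "b \<bullet> b = 1" using n[of a] n[of b] assms by simp_all
  have zz: "z = (1 - s) *\<^sub>R a + s *\<^sub>R b" by (simp add: z scaleR_conv_of_real algebra_simps)
  have "(norm z)\<^sup>2 = (1 - s)\<^sup>2 * (a \<bullet> a) + 2 * s * (1 - s) * (a \<bullet> b) + s\<^sup>2 * (b \<bullet> b)"
    unfolding n zz by (simp add: inner_add_left inner_add_right inner_commute power2_eq_square algebra_simps)
  moreover have "(norm (b - a))\<^sup>2 = b \<bullet> b - 2 * (a \<bullet> b) + a \<bullet> a"
    unfolding n by (simp add: inner_diff_left inner_diff_right inner_commute)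
  ultimately have "(norm z)\<^sup>2 = 1 - s * (1 - s) * (norm (b - a))\<^sup>2"
    unfolding aa by algebra
  moreover have "(norm z)\<^sup>2 \<le> 1" using assms(5) by (simp add: power_le_one)
  ultimately have "0 \<le> s * (1 - s) * (norm (b - a))\<^sup>2" by linarith
  moreover have "(norm (b - a))\<^sup>2 > 0" using assms(3) by simp
  ultimately have "0 \<le> s * (1 - s)" by (simp add: zero_le_mult_iff)
  then have "0 \<le> s" "s \<le> 1" by (auto simp: zero_le_mult_iff)
  then show ?thesis using zz by (auto simp: in_segment)
qed

text \<open>Along the chord from \<open>u\<close> to \<open>v\<close>, \<open>orient\<close>
  relative to the chord from \<open>x\<close> to \<open>y\<close> changes sign, so it vanishes
  somewhere. That point is in the disc, hence on both chords. If \<open>x = y\<close>, all reduces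
  to the shared vertex \<open>u\<close>.\<close>

lemma inscribed_meet:
  assumes "x \<in> X" "y \<in> X" "u \<in> Y" "v \<in> Y" "x \<le> u" "u \<le> y" "y \<le> v"
  shows "inscribed X \<inter> inscribed Y \<noteq> {}"
proof (cases "x = y")
  case True
  then have "stereo u \<in> inscribed X \<inter> inscribed Y"
    using assms unfolding inscribed_def by (auto intro!: hull_inc)
  then show ?thesis by blast
next
  case False
  let ?o = "orient (stereo x) (stereo y)"
  have xy: "x < y" using False assms by linarith
  have segs: "closed_segment (stereo x) (stereo y) \<subseteq> inscribed X"
             "closed_segment (stereo u) (stereo v) \<subseteq> inscribed Y"
    using assms unfolding inscribed_def segment_convex_hull by (auto intro!: hull_mono)
  have "connected (?o ` closed_segment (stereo u) (stereo v))"
    unfolding orient_def by (intro connected_continuous_image continuous_intros) simp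
  moreover have "?o (stereo u) \<le> 0"
    using orient_stereo_pos_iff[OF xy, of u] assms by linarith
  moreover have "?o (stereo v) \<ge> 0"
  proof (cases "y = v")
    case True
    then show ?thesis by (simp add: orient_stereo)
  next
    case False
    then show ?thesis using orient_stereo_pos_iff[OF xy, of v] assms by linarith
  qed
  ultimately have "0 \<in> ?o ` closed_segment (stereo u) (stereo v)"
    by (meson connectedD_interval ends_in_segment imageI)
  then obtain z where z: "z \<in> closed_segment (stereo u) (stereo v)" "?o z = 0" by auto
  have "closed_segment (stereo u) (stereo v) \<subseteq> cball 0 1"
    by (rule closed_segment_subset) auto
  with z have "norm z \<le> 1" by auto
  moreover have "stereo x \<noteq> stereo y" using xy injD[OF inj_stereo, of x y] by auto
  ultimately have "z \<in> closed_segment (stereo x) (stereo y)"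
    using z by (intro orient_zero_in_segment) auto
  with z segs show ?thesis by blast
qed

text \<open>Lets one lower bound, for all \<open>k \<ge> 2\<close>, serve both claims.\<close>

lemma circle_graph_eq_2_polygon: "circle_graph = polygon_circle_graph 2"
proof (intro ext iffI)
  fix n E
  assume "circle_graph n E"
  then obtain a b :: "nat \<Rightarrow> complex" where
    ab: "\<forall>i<n. norm (a i) = 1 \<and> norm (b i) = 1 \<and> a i \<noteq> b i"
    and E: "\<forall>i<n. \<forall>j<n. i \<noteq> j \<longrightarrow>
      (E i j \<longleftrightarrow> closed_segment (a i) (b i) \<inter> closed_segment (a j) (b j) \<noteq> {})"
    unfolding circle_graph_def by blast
  show "polygon_circle_graph 2 n E"
    unfolding polygon_circle_graph_def
    using ab E by (intro exI[of _ "\<lambda>i. {a i, b i}"]) (auto simp: segment_convex_hull)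
next
  fix n E
  assume "polygon_circle_graph 2 n E"
  then obtain S :: "nat \<Rightarrow> complex set" where
    S: "\<forall>i<n. finite (S i) \<and> card (S i) = 2 \<and> (\<forall>z\<in>S i. norm z = 1)"
    and E: "\<forall>i<n. \<forall>j<n. i \<noteq> j \<longrightarrow>
      (E i j \<longleftrightarrow> convex hull (S i) \<inter> convex hull (S j) \<noteq> {})"
    unfolding polygon_circle_graph_def by blast
  have "\<forall>i. \<exists>a b. i < n \<longrightarrow> S i = {a, b} \<and> a \<noteq> b"
    using S by (metis card_2_iff)
  then obtain a b where ab: "\<And>i. i < n \<Longrightarrow> S i = {a i, b i} \<and> a i \<noteq> b i" by metis
  show "circle_graph n E"
    unfolding circle_graph_def segment_convex_hull
    using ab E S by (intro exI[of _ a] exI[of _ b]) auto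
qed

text \<open>The parametrisation misses the point -1, which may be a vertex. A rotation first moves a
  point that is not a vertex there; being linear and injective, it respects hulls and
  intersections.\<close>

lemma polygon_circle_graph_inscribed:
  "polygon_circle_graph k n E \<longleftrightarrow>
     (\<exists>X. (\<forall>i<n. finite (X i) \<and> card (X i) = k) \<and>
          (\<forall>i<n. \<forall>j<n. i \<noteq> j \<longrightarrow> (E i j \<longleftrightarrow> inscribed (X i) \<inter> inscribed (X j) \<noteq> {})))"
    (is "_ \<longleftrightarrow> ?R")
proof
  assume ?R
  then obtain X where X: "\<forall>i<n. finite (X i) \<and> card (X i) = k"
      "\<forall>i<n. \<forall>j<n. i \<noteq> j \<longrightarrow> (E i j \<longleftrightarrow> inscribed (X i) \<inter> inscribed (X j) \<noteq> {})" by blast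
  then show "polygon_circle_graph k n E"
    unfolding polygon_circle_graph_def inscribed_def
    by (intro exI[of _ "\<lambda>i. stereo ` X i"])
       (auto simp: card_image inj_on_subset[OF inj_stereo])
next
  assume "polygon_circle_graph k n E"
  then obtain S :: "nat \<Rightarrow> complex set" where
    S: "\<And>i. i < n \<Longrightarrow> finite (S i) \<and> card (S i) = k \<and> (\<forall>z\<in>S i. norm z = 1)"
    and E: "\<And>i j. i < n \<Longrightarrow> j < n \<Longrightarrow> i \<noteq> j \<Longrightarrow>
      E i j \<longleftrightarrow> convex hull (S i) \<inter> convex hull (S j) \<noteq> {}"
    unfolding polygon_circle_graph_def by blast
  have "infinite (range stereo)" using inj_stereo by (simp add: finite_image_iff infinite_UNIV_char_0)
  moreover have "finite (\<Union>i<n. S i)" using S by auto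
  ultimately obtain x0 where x0: "stereo x0 \<notin> (\<Union>i<n. S i)"
    by (meson finite_subset image_subsetI)
  \<comment> \<open>Multiplication by \<open>r\<close> takes -1 to the free point
    \<open>stereo x0\<close>.\<close>
  define r where "r = - stereo x0"
  have r: "norm r = 1" "r \<noteq> 0" using norm_stereo[of x0] by (auto simp: r_def simp del: norm_stereo)
  define X where "X i = {x. r * stereo x \<in> S i}" for i
  have SX: "S i = (*) r ` stereo ` X i" if "i < n" for i
  proof
    show "S i \<subseteq> (*) r ` stereo ` X i"
    proof
      fix z assume z: "z \<in> S i"
      have "norm (z / r) = 1" using S[OF that] z r by (simp add: norm_divide)
      moreover have "z / r \<noteq> -1"
      proof
        assume "z / r = -1"
        then have "z = stereo x0" using r by (simp add: field_simps r_def)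
        with x0 z that show False by blast
      qed
      ultimately obtain x where "stereo x = z / r" by (rule stereo_surj)
      then have "z = r * stereo x" using r by simp
      with z show "z \<in> (*) r ` stereo ` X i" by (auto simp: X_def)
    qed
  qed (auto simp: X_def)
  have inj: "inj ((*) r)" using r by (simp add: inj_on_def)
  have "finite (X i) \<and> card (X i) = k" if "i < n" for i
    using S[OF that] inj inj_stereo unfolding SX[OF that]
    by (auto simp: card_image inj_on_subset finite_image_iff)
  moreover have "E i j \<longleftrightarrow> inscribed (X i) \<inter> inscribed (X j) \<noteq> {}"
    if "i < n" "j < n" "i \<noteq> j" for i j
  proof -
    have "convex hull (S i) = (*) r ` inscribed (X i)" if "i < n" for i
      unfolding SX[OF that] inscribed_def
      by (rule convex_hull_linear_image[symmetric]) (rule linear_times)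
    then show ?thesis
      using E[OF that] that inj by (simp add: image_Int[symmetric])
  qed
  ultimately show ?R by blast
qed

section \<open>Linked families of polygons\<close>

definition meets :: "real set \<Rightarrow> real set \<Rightarrow> bool" where
  "meets X Y \<longleftrightarrow> inscribed X \<inter> inscribed Y \<noteq> {}"

lemma meets_commute: "meets X Y \<longleftrightarrow> meets Y X"
  by (auto simp: meets_def)

lemma meets_interleaved:
  assumes "x \<in> X" "y \<in> X" "u \<in> Y" "v \<in> Y" "x \<le> u" "u \<le> y" "y \<le> v"
  shows "meets X Y" "meets Y X"
  using inscribed_meet[OF assms] by (auto simp: meets_def)

lemma meets_separated:
  assumes "x < y" "X \<subseteq> {x..y}" "Y \<inter> {x..y} = {}"
  shows "\<not> meets X Y" "\<not> meets Y X"
  using inscribed_disjoint[OF assms] by (auto simp: meets_def)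

text \<open>Connectedness of the intersection graph on \<open>V\<close>, phrased by closed subsets
  rather than paths, so that \<open>linkedD\<close> acts as an induction principle.\<close>

definition linked :: "('a \<Rightarrow> real set) \<Rightarrow> 'a set \<Rightarrow> bool" where
  "linked X V \<longleftrightarrow>
     (\<forall>U\<subseteq>V. U \<noteq> {} \<longrightarrow> (\<forall>u\<in>U. \<forall>v\<in>V. meets (X u) (X v) \<longrightarrow> v \<in> U) \<longrightarrow> U = V)"

lemma linkedD:
  assumes "linked X V" "U \<subseteq> V" "U \<noteq> {}"
    "\<And>u v. u \<in> U \<Longrightarrow> v \<in> V \<Longrightarrow> meets (X u) (X v) \<Longrightarrow> v \<in> U"
  shows "U = V"
  using assms unfolding linked_def by blast

lemma linked_singleton: "linked X {v}"
  by (auto simp: linked_def)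

lemma linked_insert:
  assumes "linked X V" "v \<in> V" "meets (X x) (X v)"
  shows "linked X (insert x V)"
  unfolding linked_def
proof (intro allI impI)
  fix U assume U: "U \<subseteq> insert x V" "U \<noteq> {}"
    and closed: "\<forall>u\<in>U. \<forall>v\<in>insert x V. meets (X u) (X v) \<longrightarrow> v \<in> U"
  have "U \<inter> V \<noteq> {}" using U closed assms(2,3) by blast
  then have "U \<inter> V = V" using closed by (intro linkedD[OF assms(1)]) auto
  then show "U = insert x V" using U closed assms(2,3) meets_commute by blast
qed

lemma linked_path:
  assumes "\<And>i. lo \<le> i \<Longrightarrow> i < hi \<Longrightarrow> meets (X (e i)) (X (e (Suc i)))"
  shows "linked X (e ` {lo..hi})"
  unfolding linked_def
proof (intro allI impI)
  fix U assume U: "U \<subseteq> e ` {lo..hi}" "U \<noteq> {}"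
    and closed: "\<forall>u\<in>U. \<forall>v\<in>e ` {lo..hi}. meets (X u) (X v) \<longrightarrow> v \<in> U"
  from U obtain u where "u \<in> U" by blast
  moreover from this U obtain i where "u = e i" "i \<in> {lo..hi}" by blast
  ultimately have i: "e i \<in> U" "lo \<le> i" "i \<le> hi" by auto
  have "e j \<in> U" if "lo \<le> j" "j \<le> hi" for j
  proof (cases "i \<le> j")
    case True
    then show ?thesis using \<open>j \<le> hi\<close>
    proof (induction j rule: dec_induct)
      case base show ?case by (rule i)
    next
      case (step j)
      then show ?case using assms[of j] closed i by auto
    qed
  next
    case False
    then have "j \<le> i" by simp
    then show ?thesis using \<open>lo \<le> j\<close>
    proof (induction j rule: inc_induct)
      case base show ?case by (rule i)
    next
      case (step j)
      then show ?case using assms[of j] closed i meets_commute[of "X (e j)"] by auto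
    qed
  qed
  then show "U = e ` {lo..hi}" using U by auto
qed

section \<open>Linked families and separating chords\<close>

text \<open>Polygons on different sides of the chord from \<open>s\<close> to \<open>t\<close> do
  not meet, so the members inside form a closed subset.\<close>

lemma linked_one_side:
  assumes "linked X V" "s < t"
    and sides: "\<And>v. v \<in> V \<Longrightarrow> X v \<subseteq> {s<..<t} \<or> X v \<inter> {s..t} = {}"
  shows "(\<forall>v\<in>V. X v \<subseteq> {s<..<t}) \<or> (\<forall>v\<in>V. X v \<inter> {s..t} = {})"
proof (cases "\<exists>v\<in>V. X v \<subseteq> {s<..<t}")
  case True
  have "{v\<in>V. X v \<subseteq> {s<..<t}} = V"
  proof (rule linkedD[OF assms(1)])
    fix u v assume u: "u \<in> {v\<in>V. X v \<subseteq> {s<..<t}}" and v: "v \<in> V" "meets (X u) (X v)"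
    have "X u \<subseteq> {s..t}" using u by fastforce
    then have "X v \<inter> {s..t} \<noteq> {}" using meets_separated(1)[OF \<open>s < t\<close>] v by blast
    then show "v \<in> {v\<in>V. X v \<subseteq> {s<..<t}}" using sides v by auto
  qed (use True in auto)
  then show ?thesis by blast
next
  case False
  then show ?thesis using sides by blast
qed

lemma linked_side_of_chord:
  assumes "linked X V" "s < t" "s \<in> Y" "t \<in> Y" "\<And>v. v \<in> V \<Longrightarrow> \<not> meets (X v) Y"
  shows "(\<forall>v\<in>V. X v \<subseteq> {s<..<t}) \<or> (\<forall>v\<in>V. X v \<inter> {s..t} = {})"
proof (rule linked_one_side[OF assms(1,2)], rule ccontr)
  fix v assume v: "v \<in> V" and "\<not> (X v \<subseteq> {s<..<t} \<or> X v \<inter> {s..t} = {})"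
  then obtain x y where "x \<in> X v" "x \<in> {s..t}" "y \<in> X v" "y \<notin> {s<..<t}" by blast
  then have xy: "x \<in> X v" "y \<in> X v" "s \<le> x" "x \<le> t" "y \<le> s \<or> t \<le> y" by auto
  show False
  proof (cases "y \<le> s")
    case True
    show ?thesis using meets_interleaved(1)[of y "X v" x s Y t] xy True assms v by auto
  next
    case False
    then show ?thesis using meets_interleaved(2)[of s Y t x "X v" y] xy assms v by auto
  qed
qed

text \<open>The points \<open>s\<close> and \<open>t\<close> may belong to different members of
  \<open>U\<close>, so no single polygon contains the chord between them. If some \<open>X v\<close>
  had vertices on both sides, its own chord would separate \<open>s\<close> from \<open>t\<close>,
  although the linked family \<open>U\<close> avoids it.\<close>

lemma linked_noncrossing:
  assumes "linked X U" "linked X V"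
    and anti: "\<And>u v. u \<in> U \<Longrightarrow> v \<in> V \<Longrightarrow> \<not> meets (X u) (X v)"
    and st: "s < t" "u \<in> U" "s \<in> X u" "u' \<in> U" "t \<in> X u'"
  shows "(\<forall>v\<in>V. X v \<subseteq> {s<..<t}) \<or> (\<forall>v\<in>V. X v \<inter> {s..t} = {})"
proof (rule linked_one_side[OF assms(2) st(1)], rule ccontr)
  fix v assume v: "v \<in> V" and "\<not> (X v \<subseteq> {s<..<t} \<or> X v \<inter> {s..t} = {})"
  then obtain x y where "x \<in> X v" "x \<in> {s..t}" "y \<in> X v" "y \<notin> {s<..<t}" by blast
  then have xy: "x \<in> X v" "y \<in> X v" "s \<le> x" "x \<le> t" "y \<le> s \<or> t \<le> y" by auto
  have sep: "(\<forall>u\<in>U. X u \<subseteq> {x'<..<y'}) \<or> (\<forall>u\<in>U. X u \<inter> {x'..y'} = {})"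
    if "x' < y'" "x' \<in> X v" "y' \<in> X v" for x' y'
    using linked_side_of_chord[OF assms(1) that] anti v by blast
  have "s \<notin> X v" "t \<notin> X v"
    using anti[OF st(2) v] anti[OF st(4) v] st meets_interleaved(1) by blast+
  then have "s < x" "x < t" "y < s \<or> t < y" using xy by (auto simp: less_le)
  then show False
  proof (elim disjE)
    assume "y < s"
    with sep[of y x] xy st \<open>s < x\<close> show False by fastforce
  next
    assume "t < y"
    with sep[of x y] xy st \<open>x < t\<close> show False by fastforce
  qed
qed

text \<open>Otherwise the rungs \<open>a x\<close> and \<open>a z\<close>, joined by the piece of
  path between their feet, form a linked family avoiding \<open>a y\<close>. It encloses
  \<open>a y\<close> between \<open>\<alpha>\<close> and \<open>\<gamma>\<close>, away from the
  polygon \<open>v\<close> that \<open>a y\<close> has to meet.\<close>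

lemma rung_between:
  fixes r :: "'b \<Rightarrow> nat"
  assumes path: "\<And>i. i < M \<Longrightarrow> meets (X (e i)) (X (e (Suc i)))"
    and le: "r x \<le> M" "r z \<le> M"
    and att: "meets (X (a x)) (X (e (r x)))" "meets (X (a z)) (X (e (r z)))"
    and free: "\<And>j. j \<le> M \<Longrightarrow> j \<noteq> r y \<Longrightarrow> \<not> meets (X (a y)) (X (e j))"
    and disj: "\<not> meets (X (a x)) (X (a y))" "\<not> meets (X (a z)) (X (a y))"
    and neq: "r x \<noteq> r y" "r z \<noteq> r y"
    and pts: "\<alpha> \<in> X (a x)" "\<beta> \<in> X (a y)" "\<gamma> \<in> X (a z)" "\<alpha> < \<beta>" "\<beta> < \<gamma>"
    and out: "meets (X (a y)) (X v)" "X v \<inter> {\<alpha>..\<gamma>} = {}"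
  shows "r x < r y \<and> r y < r z \<or> r z < r y \<and> r y < r x"
proof (rule ccontr)
  assume contra: "\<not> ?thesis"
  define P where "P = e ` {min (r x) (r z)..max (r x) (r z)}"
  have "linked X P" unfolding P_def using le by (intro linked_path path) auto
  then have "linked X (insert (a z) P)"
    using att by (rule_tac v = "e (r z)" in linked_insert) (auto simp: P_def)
  then have lV: "linked X (insert (a x) (insert (a z) P))"
    using att by (rule_tac v = "e (r x)" in linked_insert) (auto simp: P_def)
  have "\<not> meets (X u) (X (a y))" if "u \<in> insert (a x) (insert (a z) P)" for u
  proof (cases "u \<in> P")
    case True
    then obtain j where "u = e j" "min (r x) (r z) \<le> j" "j \<le> max (r x) (r z)"
      by (auto simp: P_def)
    moreover from this have "j \<noteq> r y" "j \<le> M" using contra neq le by auto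
    ultimately show ?thesis using free meets_commute by metis
  qed (use that disj in auto)
  then have "X (a y) \<subseteq> {\<alpha><..<\<gamma>} \<or> X (a y) \<inter> {\<alpha>..\<gamma>} = {}"
    using linked_noncrossing[OF lV linked_singleton[of X "a y"], of \<alpha> \<gamma> "a x" "a z"] pts by auto
  then have "X (a y) \<subseteq> {\<alpha>..\<gamma>}" using pts by fastforce
  then show False using meets_separated(1)[of \<alpha> \<gamma>] out pts by auto
qed

text \<open>The points where the rungs touch the arc of the second path order the rungs linearly; a rung
  that lies between two others cannot be bypassed by either path.\<close>

lemma rungs_ordered_aux:
  fixes p q :: "'b \<Rightarrow> nat"
  assumes cpath: "\<And>i. i < M \<Longrightarrow> meets (X (c i)) (X (c (Suc i)))"
    and dpath: "\<And>i. i < N \<Longrightarrow> meets (X (d i)) (X (d (Suc i)))"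
    and pq: "\<And>i. i \<in> I \<Longrightarrow> p i \<le> M" "\<And>i. i \<in> I \<Longrightarrow> q i \<le> N" "inj_on p I" "inj_on q I"
    and ac: "\<And>i j. i \<in> I \<Longrightarrow> j \<le> M \<Longrightarrow> meets (X (a i)) (X (c j)) \<longleftrightarrow> j = p i"
    and ad: "\<And>i j. i \<in> I \<Longrightarrow> j \<le> N \<Longrightarrow> meets (X (a i)) (X (d j)) \<longleftrightarrow> j = q i"
    and aa: "\<And>i j. i \<in> I \<Longrightarrow> j \<in> I \<Longrightarrow> i \<noteq> j \<Longrightarrow> \<not> meets (X (a i)) (X (a j))"
    and st: "s < t" "\<And>j. j \<le> N \<Longrightarrow> X (d j) \<subseteq> {s..t}" "\<And>i. i \<le> M \<Longrightarrow> X (c i) \<inter> {s..t} = {}"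
  shows "\<exists>\<theta> :: 'b \<Rightarrow> real. inj_on \<theta> I \<and> (\<forall>x\<in>I. \<forall>y\<in>I. \<forall>z\<in>I. \<theta> x < \<theta> y \<longrightarrow> \<theta> y < \<theta> z \<longrightarrow>
           (p x < p y \<and> p y < p z \<or> p z < p y \<and> p y < p x) \<and>
           (q x < q y \<and> q y < q z \<or> q z < q y \<and> q y < q x))"
proof -
  have "\<exists>u. u \<in> X (a i) \<inter> {s..t}" if "i \<in> I" for i
    using meets_separated(2)[OF st(1) st(2)[of "q i"], of "X (a i)"] ad[OF that] pq that by blast
  then obtain \<theta> where \<theta>: "\<And>i. i \<in> I \<Longrightarrow> \<theta> i \<in> X (a i) \<and> s \<le> \<theta> i \<and> \<theta> i \<le> t"
    by (metis Int_iff atLeastAtMost_iff)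
  have "inj_on \<theta> I"
    using \<theta> aa meets_interleaved(1) by (intro inj_onI) (metis order_refl)
  moreover have "(p x < p y \<and> p y < p z \<or> p z < p y \<and> p y < p x) \<and>
           (q x < q y \<and> q y < q z \<or> q z < q y \<and> q y < q x)"
    if xyz: "x \<in> I" "y \<in> I" "z \<in> I" and less: "\<theta> x < \<theta> y" "\<theta> y < \<theta> z" for x y z
  proof -
    have ne: "x \<noteq> y" "z \<noteq> y" using less by auto
    have neq: "p x \<noteq> p y" "p z \<noteq> p y" "q x \<noteq> q y" "q z \<noteq> q y"
      using ne xyz pq by (auto dest: inj_onD)
    \<comment> \<open>The rung \<open>a y\<close> meets this polygon of the outer path; it is the
      outside neighbour for both applications of \<open>rung_between\<close>.\<close>
    have out: "X (c (p y)) \<inter> {\<theta> x..\<theta> z} = {}"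
      using st(3)[OF pq(1)[OF xyz(2)]] \<theta>[OF xyz(1)] \<theta>[OF xyz(3)] by fastforce
    have "p x < p y \<and> p y < p z \<or> p z < p y \<and> p y < p x"
      by (rule rung_between[where X = X and e = c and M = M and a = a and \<alpha> = "\<theta> x" and \<beta> = "\<theta> y"
            and \<gamma> = "\<theta> z" and v = "c (p y)"])
        (use xyz less ne neq out \<theta> pq cpath ac aa in auto)
    moreover have "q x < q y \<and> q y < q z \<or> q z < q y \<and> q y < q x"
      by (rule rung_between[where X = X and e = d and M = N and a = a and \<alpha> = "\<theta> x" and \<beta> = "\<theta> y"
            and \<gamma> = "\<theta> z" and v = "c (p y)"])
        (use xyz less ne neq out \<theta> pq dpath ac ad aa in auto)
    ultimately show ?thesis by blast
  qed
  ultimately show ?thesis by blast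
qed

lemma finite_family_range:
  fixes X :: "nat \<Rightarrow> real set"
  assumes fin: "\<And>i. i \<le> K \<Longrightarrow> finite (X i) \<and> card (X i) \<ge> 2"
  obtains s t i j where "s < t" "i \<le> K" "s \<in> X i" "j \<le> K" "t \<in> X j"
    "\<And>i. i \<le> K \<Longrightarrow> X i \<subseteq> {s..t}"
proof -
  define U where "U = (\<Union>i\<le>K. X i)"
  have f: "finite U" using fin by (auto simp: U_def)
  have mem: "x \<in> U \<longleftrightarrow> (\<exists>i\<le>K. x \<in> X i)" for x by (auto simp: U_def)
  obtain x y where xy: "x \<in> X 0" "y \<in> X 0" "x \<noteq> y"
    using fin[of 0] card_le_Suc0_iff_eq[of "X 0"] by fastforce
  then have U: "x \<in> U" "y \<in> U" by (auto simp: U_def)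
  have "Min U \<in> U" "Max U \<in> U" using Min_in[OF f] Max_in[OF f] U by blast+
  then obtain i j where "i \<le> K" "Min U \<in> X i" "j \<le> K" "Max U \<in> X j" unfolding mem by blast
  moreover have "Min U < Max U"
    using Min_le[OF f U(1)] Max_ge[OF f U(1)] Min_le[OF f U(2)] Max_ge[OF f U(2)] xy(3) by linarith
  moreover have "X i \<subseteq> {Min U..Max U}" if "i \<le> K" for i
  proof -
    have "X i \<subseteq> U" using that by (auto simp: U_def)
    then show ?thesis using Min_le[OF f] Max_ge[OF f] by auto
  qed
  ultimately show ?thesis using that by blast
qed

text \<open>Each path lies entirely inside or entirely outside the span of the other. They cannot be
  inside each other, so up to exchanging their roles \<open>rungs_ordered_aux\<close>
  applies.\<close>

lemma rungs_ordered:
  fixes p q :: "'b \<Rightarrow> nat"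
  assumes cpath: "\<And>i. i < M \<Longrightarrow> meets (X (c i)) (X (c (Suc i)))"
    and dpath: "\<And>i. i < N \<Longrightarrow> meets (X (d i)) (X (d (Suc i)))"
    and cd: "\<And>i j. i \<le> M \<Longrightarrow> j \<le> N \<Longrightarrow> \<not> meets (X (c i)) (X (d j))"
    and cfin: "\<And>i. i \<le> M \<Longrightarrow> finite (X (c i)) \<and> card (X (c i)) \<ge> 2"
    and dfin: "\<And>i. i \<le> N \<Longrightarrow> finite (X (d i)) \<and> card (X (d i)) \<ge> 2"
    and pq: "\<And>i. i \<in> I \<Longrightarrow> p i \<le> M" "\<And>i. i \<in> I \<Longrightarrow> q i \<le> N" "inj_on p I" "inj_on q I"
    and ac: "\<And>i j. i \<in> I \<Longrightarrow> j \<le> M \<Longrightarrow> meets (X (a i)) (X (c j)) \<longleftrightarrow> j = p i"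
    and ad: "\<And>i j. i \<in> I \<Longrightarrow> j \<le> N \<Longrightarrow> meets (X (a i)) (X (d j)) \<longleftrightarrow> j = q i"
    and aa: "\<And>i j. i \<in> I \<Longrightarrow> j \<in> I \<Longrightarrow> i \<noteq> j \<Longrightarrow> \<not> meets (X (a i)) (X (a j))"
  shows "\<exists>\<theta> :: 'b \<Rightarrow> real. inj_on \<theta> I \<and> (\<forall>x\<in>I. \<forall>y\<in>I. \<forall>z\<in>I. \<theta> x < \<theta> y \<longrightarrow> \<theta> y < \<theta> z \<longrightarrow>
           (p x < p y \<and> p y < p z \<or> p z < p y \<and> p y < p x) \<and>
           (q x < q y \<and> q y < q z \<or> q z < q y \<and> q y < q x))"
proof -
  have lc: "linked X (c ` {0..M})" and ld: "linked X (d ` {0..N})"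
    by (intro linked_path cpath dpath; simp)+
  obtain s t i0 j0 where st: "s < t" "i0 \<le> N" "s \<in> X (d i0)" "j0 \<le> N" "t \<in> X (d j0)"
    "\<And>i. i \<le> N \<Longrightarrow> X (d i) \<subseteq> {s..t}"
    using finite_family_range[of N "\<lambda>i. X (d i)"] dfin by blast
  obtain s' t' i1 j1 where st': "s' < t'" "i1 \<le> M" "s' \<in> X (c i1)" "j1 \<le> M" "t' \<in> X (c j1)"
    "\<And>i. i \<le> M \<Longrightarrow> X (c i) \<subseteq> {s'..t'}"
    using finite_family_range[of M "\<lambda>i. X (c i)"] cfin by blast
  have anti: "\<not> meets (X u) (X v)" "\<not> meets (X v) (X u)" if "u \<in> c ` {0..M}" "v \<in> d ` {0..N}" for u v
    using that cd meets_commute by fastforce+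
  have cside: "(\<forall>v\<in>c ` {0..M}. X v \<subseteq> {s<..<t}) \<or> (\<forall>v\<in>c ` {0..M}. X v \<inter> {s..t} = {})"
    by (rule linked_noncrossing[OF ld lc anti(2), of s t "d i0" "d j0"]) (use st in auto)
  have dside: "(\<forall>v\<in>d ` {0..N}. X v \<subseteq> {s'<..<t'}) \<or> (\<forall>v\<in>d ` {0..N}. X v \<inter> {s'..t'} = {})"
    by (rule linked_noncrossing[OF lc ld anti(1), of s' t' "c i1" "c j1"]) (use st' in auto)
  show ?thesis
  proof (cases "\<forall>i\<le>M. X (c i) \<inter> {s..t} = {}")
    case True
    show ?thesis
      by (rule rungs_ordered_aux[where X = X and c = c and d = d and M = M and N = N and a = a
            and s = s and t = t, OF cpath dpath pq ac ad aa])
        (use st True in auto)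
  next
    case False
    \<comment> \<open>If the \<open>c\<close> path lies inside the span of the \<open>d\<close>
      path, then the \<open>d\<close> path has the vertex \<open>s\<close> to the left of
      \<open>s'\<close>, hence lies outside the span of the \<open>c\<close> path.\<close>
    then have "X (c i1) \<subseteq> {s<..<t}" using cside st'(2) by fastforce
    then have "s < s'" using st'(3) by auto
    then have "\<not> X (d i0) \<subseteq> {s'<..<t'}" using st(3) by auto
    then have out: "\<forall>j\<le>N. X (d j) \<inter> {s'..t'} = {}" using dside st(2) by fastforce
    have "\<exists>\<theta> :: 'b \<Rightarrow> real. inj_on \<theta> I \<and> (\<forall>x\<in>I. \<forall>y\<in>I. \<forall>z\<in>I. \<theta> x < \<theta> y \<longrightarrow> \<theta> y < \<theta> z \<longrightarrow>
           (q x < q y \<and> q y < q z \<or> q z < q y \<and> q y < q x) \<and>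
           (p x < p y \<and> p y < p z \<or> p z < p y \<and> p y < p x))"
      by (rule rungs_ordered_aux[where X = X and c = d and d = c and M = N and N = M and a = a
            and s = s' and t = t', OF dpath cpath pq(2,1,4,3) ad ac aa])
        (use st' out in auto)
    then show ?thesis by (simp only: conj_commute)
  qed
qed

section \<open>Ladders\<close>

text \<open>For ranks \<open>p\<close>, \<open>q\<close> the ladder has vertices \<open>c\<^sub>u = u\<close> for \<open>u < m\<close>, \<open>a\<^sub>i = m + i\<close> and
  \<open>d\<^sub>i = m + w + i\<close> for \<open>i < w\<close>: the \<open>c\<^sub>u\<close> form a path in the order of their \<open>p\<close>-ranks, the
  \<open>d\<^sub>i\<close> a path in the order of their \<open>q\<close>-ranks, and \<open>c\<^sub>i - a\<^sub>i - d\<^sub>i\<close> are the rungs. Taking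
  \<open>m > w\<close> lengthens the first path, so that every number of vertices can be reached.\<close>

definition ladder_arc :: "nat \<Rightarrow> nat \<Rightarrow> (nat \<Rightarrow> nat) \<Rightarrow> (nat \<Rightarrow> nat) \<Rightarrow> nat \<Rightarrow> nat \<Rightarrow> bool" where
  "ladder_arc w m p q u v \<longleftrightarrow>
     u < m \<and> v < m \<and> p v = Suc (p u) \<or>
     (\<exists>i<w. u = i \<and> v = m + i \<or> u = m + i \<and> v = m + w + i) \<or>
     (\<exists>i<w. \<exists>j<w. u = m + w + i \<and> v = m + w + j \<and> q j = Suc (q i))"

definition ladder :: "nat \<Rightarrow> nat \<Rightarrow> (nat \<Rightarrow> nat) \<Rightarrow> (nat \<Rightarrow> nat) \<Rightarrow> nat \<Rightarrow> nat \<Rightarrow> bool" where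
  "ladder w m p q u v \<longleftrightarrow> ladder_arc w m p q u v \<or> ladder_arc w m p q v u"

lemma ladder_commute: "ladder w m p q u v \<longleftrightarrow> ladder w m p q v u"
  by (auto simp: ladder_def)

lemma ladder_cases:
  fixes v m w :: nat
  assumes "v < m + 2 * w"
  obtains (c) "v < m" | (a) i where "i < w" "v = m + i" | (d) i where "i < w" "v = m + w + i"
proof -
  consider "v < m" | "m \<le> v" "v < m + w" | "m + w \<le> v" by linarith
  then show ?thesis
  proof cases
    case 2
    then show ?thesis using a[of "v - m"] by auto
  next
    case 3
    then show ?thesis using d[of "v - m - w"] assms by auto
  qed (rule c)
qed

context
  fixes w m :: nat and p q :: "nat \<Rightarrow> nat"
  assumes wm: "w \<le> m"
begin

lemma ladder_cc: "u < m \<Longrightarrow> v < m \<Longrightarrow> ladder w m p q u v \<longleftrightarrow> p v = Suc (p u) \<or> p u = Suc (p v)"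
  using wm by (auto simp: ladder_def ladder_arc_def)

lemma ladder_ac: "i < w \<Longrightarrow> u < m \<Longrightarrow> ladder w m p q (m + i) u \<longleftrightarrow> u = i"
  using wm by (auto simp: ladder_def ladder_arc_def)

lemma ladder_cd: "u < m \<Longrightarrow> i < w \<Longrightarrow> \<not> ladder w m p q u (m + w + i)"
  using wm by (auto simp: ladder_def ladder_arc_def)

lemma ladder_aa: "i < w \<Longrightarrow> j < w \<Longrightarrow> \<not> ladder w m p q (m + i) (m + j)"
  using wm by (auto simp: ladder_def ladder_arc_def)

lemma ladder_ad: "i < w \<Longrightarrow> j < w \<Longrightarrow> ladder w m p q (m + i) (m + w + j) \<longleftrightarrow> j = i"
  using wm by (auto simp: ladder_def ladder_arc_def)

lemma ladder_dd:
  "i < w \<Longrightarrow> j < w \<Longrightarrow> ladder w m p q (m + w + i) (m + w + j) \<longleftrightarrow> q j = Suc (q i) \<or> q i = Suc (q j)"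
  using wm by (auto simp: ladder_def ladder_arc_def)

lemma simple_graph_ladder: "simple_graph (m + 2 * w) (ladder w m p q)"
  using wm unfolding simple_graph_def by (auto simp: ladder_def ladder_arc_def)

end

section \<open>Ladders are connected\<close>

lemma permutes_less_iff:
  assumes "p permutes {1..<w}" "w \<le> m"
  shows "p x < m \<longleftrightarrow> x < (m::nat)"
proof (cases "x \<in> {1..<w}")
  case True
  then have "p x \<in> {1..<w}" using permutes_in_image[OF assms(1)] by blast
  then show ?thesis using True assms(2) by auto
qed (use permutes_not_in[OF assms(1)] in auto)

text \<open>The first path is reached from vertex 0 by induction on the rank \<open>p\<close>, and
  the remaining vertices through the rungs.\<close>

lemma connected_graph_ladder:
  assumes "w \<le> m" "p permutes {1..<w}"
  shows "connected_graph (m + 2 * w) (ladder w m p q)"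
proof -
  let ?E = "{(x, y). ladder w m p q x y}"
  have sym: "sym (?E\<^sup>*)" by (rule sym_rtrancl) (auto simp: sym_def ladder_commute)
  have p0: "p 0 = 0" using permutes_not_in[OF assms(2)] by auto
  have c: "(0, v) \<in> ?E\<^sup>*" if "v < m" for v
    using that
  proof (induction "p v" arbitrary: v)
    case 0
    then have "v = 0" using p0 permutes_inj[OF assms(2)] by (metis injD)
    then show ?case by simp
  next
    case (Suc k)
    define u where "u = inv p k"
    have pu: "p u = k" unfolding u_def by (rule permutes_inverses(1)[OF assms(2)])
    have "p v < m" using Suc.prems permutes_less_iff[OF assms(2,1)] by blast
    then have "u < m" using pu Suc.hyps(2) permutes_less_iff[OF assms(2,1), of u] by simp
    then have "(0, u) \<in> ?E\<^sup>*" using Suc.hyps(1) pu by auto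
    moreover have "(u, v) \<in> ?E"
      using ladder_cc[OF assms(1) \<open>u < m\<close> Suc.prems] pu Suc.hyps(2) by auto
    ultimately show ?case by (rule rtrancl_into_rtrancl)
  qed
  have a: "(0, m + i) \<in> ?E\<^sup>*" if "i < w" for i
  proof -
    have "(i, m + i) \<in> ?E"
      using ladder_ac[OF assms(1) that, of i p q] that assms(1) by (simp add: ladder_commute)
    then show ?thesis using c[of i] that assms(1) by (meson order_less_le_trans rtrancl_into_rtrancl)
  qed
  have d: "(0, m + w + i) \<in> ?E\<^sup>*" if "i < w" for i
  proof -
    have "(m + i, m + w + i) \<in> ?E" using ladder_ad[OF assms(1) that that] by simp
    then show ?thesis using a[OF that] by (meson rtrancl_into_rtrancl)
  qed
  have "(0, v) \<in> ?E\<^sup>*" if "v < m + 2 * w" for v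
    using that by (cases rule: ladder_cases) (use a c d in auto)
  then show ?thesis
    unfolding connected_graph_def using sym by (meson rtrancl_trans symD)
qed

section \<open>Mixed ladders are no-instances\<close>

text \<open>The value \<open>p x\<close> is an element of \<open>S\<close> determined by how many
  elements of \<open>S\<close> lie below it; this number is a count of indices that depends only on
  the order induced by \<open>p\<close>.\<close>

lemma permutes_eqI_order:
  fixes p q :: "nat \<Rightarrow> nat"
  assumes p: "p permutes S" and q: "q permutes S" and "finite S"
    and ord: "\<And>i j. i \<in> S \<Longrightarrow> j \<in> S \<Longrightarrow> p i < p j \<longleftrightarrow> q i < q j"
  shows "p = q"
proof
  have rank: "card {y\<in>S. y < r x} = card {j\<in>S. r j < r x}" if "r permutes S" for r x
  proof -
    have "{y\<in>S. y < r x} = r ` {j\<in>S. r j < r x}"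
      using permutes_image[OF that] by auto
    then show ?thesis using permutes_inj[OF that] by (simp add: card_image inj_on_def)
  qed
  fix x show "p x = q x"
  proof (cases "x \<in> S")
    case True
    have "{j\<in>S. p j < p x} = {j\<in>S. q j < q x}" using ord True by blast
    then have eq: "card {y\<in>S. y < p x} = card {y\<in>S. y < q x}" by (simp add: rank p q)
    have mem: "p x \<in> S" "q x \<in> S" using True p q by (auto simp: permutes_in_image)
    have less: "card {y\<in>S. y < a} < card {y\<in>S. y < b}" if "a < b" "a \<in> S" for a b
      using that \<open>finite S\<close> by (intro psubset_card_mono) auto
    show ?thesis using less[of "p x" "q x"] less[of "q x" "p x"] eq mem
      by (metis less_irrefl nat_neq_iff)
  qed (use p q in \<open>auto simp: permutes_not_in\<close>)
qed

lemma ladder_not_polygon_circle_graph: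
  assumes wm: "w \<le> m" and p: "p permutes {1..<w}" and q: "q permutes {1..<w}"
    and "p \<noteq> q" and "k \<ge> 2"
  shows "\<not> polygon_circle_graph k (m + 2 * w) (ladder w m p q)"
proof
  assume "polygon_circle_graph k (m + 2 * w) (ladder w m p q)"
  then obtain X where X: "\<And>i. i < m + 2 * w \<Longrightarrow> finite (X i) \<and> card (X i) = k"
    and E: "\<And>i j. i < m + 2 * w \<Longrightarrow> j < m + 2 * w \<Longrightarrow> i \<noteq> j \<Longrightarrow>
      meets (X i) (X j) \<longleftrightarrow> ladder w m p q i j"
    unfolding polygon_circle_graph_inscribed meets_def by blast
  have "w > 0"
  proof (rule ccontr)
    assume "\<not> w > 0"
    then show False using p q \<open>p \<noteq> q\<close> by simp
  qed
  have ip: "inv p permutes {1..<w}" and iq: "inv q permutes {1..<w}"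
    using p q by (auto intro: permutes_inv)
  have pinv: "p (inv p i) = i" "inv p (p i) = i" and qinv: "q (inv q i) = i" "inv q (q i) = i" for i
    using permutes_inverses[OF p] permutes_inverses[OF q] by auto
  have lt: "inv p i < m" if "i \<le> m - 1" for i
    using permutes_less_iff[OF ip wm] that \<open>w > 0\<close> wm by auto
  have lt': "inv q i < w" if "i \<le> w - 1" for i
    using permutes_less_iff[OF iq order_refl] that \<open>w > 0\<close> by auto
  have "\<exists>\<theta> :: nat \<Rightarrow> real. inj_on \<theta> {..<w} \<and> (\<forall>x\<in>{..<w}. \<forall>y\<in>{..<w}. \<forall>z\<in>{..<w}. \<theta> x < \<theta> y \<longrightarrow> \<theta> y < \<theta> z \<longrightarrow>
           (p x < p y \<and> p y < p z \<or> p z < p y \<and> p y < p x) \<and>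
           (q x < q y \<and> q y < q z \<or> q z < q y \<and> q y < q x))"
  \<comment> \<open>The inverse permutations list the path vertices by position, since
    \<open>p\<close> and \<open>q\<close> give ranks.\<close>
  proof (rule rungs_ordered[where X = X and a = "\<lambda>i. m + i" and c = "inv p" and d = "\<lambda>i. m + w + inv q i"
        and M = "m - 1" and N = "w - 1"])
    show "meets (X (inv p i)) (X (inv p (Suc i)))" if "i < m - 1" for i
    proof -
      have "inv p i < m" "inv p (Suc i) < m" using that lt by auto
      moreover have "inv p i \<noteq> inv p (Suc i)" using pinv by (metis n_not_Suc_n)
      ultimately show ?thesis using wm by (simp add: E ladder_cc pinv)
    qed
    show "meets (X (m + w + inv q i)) (X (m + w + inv q (Suc i)))" if "i < w - 1" for i
    proof -
      have "inv q i < w" "inv q (Suc i) < w" using that lt' by auto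
      moreover have "inv q i \<noteq> inv q (Suc i)" using qinv by (metis n_not_Suc_n)
      ultimately show ?thesis using wm by (simp add: E ladder_dd qinv)
    qed
    show "\<not> meets (X (inv p i)) (X (m + w + inv q j))" if "i \<le> m - 1" "j \<le> w - 1" for i j
      using lt[OF that(1)] lt'[OF that(2)] wm by (simp add: E ladder_cd)
    show "finite (X (inv p i)) \<and> 2 \<le> card (X (inv p i))" if "i \<le> m - 1" for i
      using lt[OF that] X \<open>k \<ge> 2\<close> by auto
    show "finite (X (m + w + inv q i)) \<and> 2 \<le> card (X (m + w + inv q i))" if "i \<le> w - 1" for i
      using lt'[OF that] X \<open>k \<ge> 2\<close> by auto
    show "p i \<le> m - 1" if "i \<in> {..<w}" for i
      using permutes_less_iff[OF p wm, of i] that wm by auto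
    show "q i \<le> w - 1" if "i \<in> {..<w}" for i
      using permutes_less_iff[OF q order_refl, of i] that by auto
    show "inj_on p {..<w}" "inj_on q {..<w}"
      using p q by (auto intro: permutes_inj_on)
    show "meets (X (m + i)) (X (inv p j)) \<longleftrightarrow> j = p i" if "i \<in> {..<w}" "j \<le> m - 1" for i j
    proof -
      have "meets (X (m + i)) (X (inv p j)) \<longleftrightarrow> inv p j = i"
        using lt[OF that(2)] that(1) wm by (simp add: E ladder_ac)
      then show ?thesis using pinv by metis
    qed
    show "meets (X (m + i)) (X (m + w + inv q j)) \<longleftrightarrow> j = q i" if "i \<in> {..<w}" "j \<le> w - 1" for i j
    proof -
      have "meets (X (m + i)) (X (m + w + inv q j)) \<longleftrightarrow> inv q j = i"
        using lt'[OF that(2)] that(1) wm by (simp add: E ladder_ad)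
      then show ?thesis using qinv by metis
    qed
    show "\<not> meets (X (m + i)) (X (m + j))" if "i \<in> {..<w}" "j \<in> {..<w}" "i \<noteq> j" for i j
      using that wm by (simp add: E ladder_aa)
  qed
  then obtain \<theta> :: "nat \<Rightarrow> real" where inj: "inj_on \<theta> {..<w}"
    and \<theta>: "\<And>x y z. x < w \<Longrightarrow> y < w \<Longrightarrow> z < w \<Longrightarrow> \<theta> x < \<theta> y \<Longrightarrow> \<theta> y < \<theta> z \<Longrightarrow>
           (p x < p y \<and> p y < p z \<or> p z < p y \<and> p y < p x) \<and>
           (q x < q y \<and> q y < q z \<or> q z < q y \<and> q y < q x)"
    by (metis lessThan_iff)
  have "p = q"
  proof (rule permutes_eqI_order[OF p q])
    fix i j assume ij: "i \<in> {1..<w}" "j \<in> {1..<w}"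
    have 0: "p 0 = 0" "q 0 = 0" using permutes_not_in[OF p] permutes_not_in[OF q] by auto
    have pos: "p i > 0" "p j > 0" "q i > 0" "q j > 0"
      using ij permutes_in_image[OF p, of i] permutes_in_image[OF p, of j]
        permutes_in_image[OF q, of i] permutes_in_image[OF q, of j] by auto
    show "p i < p j \<longleftrightarrow> q i < q j"
    proof (cases "i = j")
      case False
      then have "\<theta> i \<noteq> \<theta> j" "\<theta> 0 \<noteq> \<theta> i" "\<theta> 0 \<noteq> \<theta> j"
        using inj ij by (auto dest: inj_onD)
      \<comment> \<open>Rung 0 has rank 0 for both permutations, so it is never strictly between two
        others: the middle position in \<open>\<theta>\<close> is contradictory, and an end position
        fixes the direction for \<open>p\<close> and \<open>q\<close> simultaneously.\<close>
      then consider "\<theta> 0 < \<theta> i" "\<theta> i < \<theta> j" | "\<theta> 0 < \<theta> j" "\<theta> j < \<theta> i" | "\<theta> i < \<theta> 0" "\<theta> 0 < \<theta> j"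
        | "\<theta> j < \<theta> 0" "\<theta> 0 < \<theta> i" | "\<theta> i < \<theta> j" "\<theta> j < \<theta> 0" | "\<theta> j < \<theta> i" "\<theta> i < \<theta> 0"
        by linarith
      then show ?thesis
      proof cases
        case 1 then show ?thesis using \<theta>[of 0 i j] ij pos 0 by auto
      next
        case 2 then show ?thesis using \<theta>[of 0 j i] ij pos 0 by auto
      next
        case 3 then show ?thesis using \<theta>[of i 0 j] ij pos 0 by auto
      next
        case 4 then show ?thesis using \<theta>[of j 0 i] ij pos 0 by auto
      next
        case 5 then show ?thesis using \<theta>[of i j 0] ij pos 0 by auto
      next
        case 6 then show ?thesis using \<theta>[of j i 0] ij pos 0 by auto
      qed
    qed simp
  qed simp
  with \<open>p \<noteq> q\<close> show False ..
qed

section \<open>Unmixed ladders are yes-instances\<close>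

text \<open>Overlapping intervals are crossing chords. Integer endpoints leave gaps of length 1, in
  which a chord can be thickened to any number of vertices.\<close>

lemma polygon_circle_graph_intervals:
  fixes l r :: "nat \<Rightarrow> int"
  assumes "k \<ge> 2"
    and lr: "\<And>v. v < n \<Longrightarrow> l v < r v"
    and dist: "\<And>u v. u < n \<Longrightarrow> v < n \<Longrightarrow> u \<noteq> v \<Longrightarrow> l u \<noteq> l v \<and> r u \<noteq> r v \<and> l u \<noteq> r v"
    and E: "\<And>u v. u < n \<Longrightarrow> v < n \<Longrightarrow> u \<noteq> v \<Longrightarrow>
       E u v \<longleftrightarrow> l u < l v \<and> l v < r u \<and> r u < r v \<or> l v < l u \<and> l u < r v \<and> r v < r u"
  shows "polygon_circle_graph k n E"
proof -
  \<comment> \<open>The chord from \<open>l v\<close> to \<open>r v\<close> becomes a thin polygon with \<open>k - 1\<close> vertices in \<open>[r v, r v + 1)\<close>.\<close>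
  define Y where "Y v = (\<lambda>j. real_of_int (r v) + real j / (2 * real k)) ` {..<k - 1}" for v
  define X where "X v = insert (real_of_int (l v)) (Y v)" for v
  have Y: "real_of_int (r v) \<le> y \<and> y < real_of_int (r v) + 1" if "y \<in> Y v" for v y
    using that \<open>k \<ge> 2\<close> by (auto simp: Y_def field_simps)
  have rX: "real_of_int (r v) \<in> X v" and lX: "real_of_int (l v) \<in> X v" for v
    using \<open>k \<ge> 2\<close> by (auto simp: X_def Y_def intro!: image_eqI[of _ _ 0])
  have card: "finite (X v) \<and> card (X v) = k" if "v < n" for v
  proof -
    have "card (Y v) = k - 1" "finite (Y v)"
      using \<open>k \<ge> 2\<close> by (auto simp: Y_def card_image inj_on_def)
    moreover have "real_of_int (l v) \<notin> Y v" using Y[of "real_of_int (l v)" v] lr[OF that] by auto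
    ultimately show ?thesis using \<open>k \<ge> 2\<close> by (auto simp: X_def)
  qed
  have int_step: "real_of_int a + 1 \<le> real_of_int b" if "a < b" for a b
    using that by linarith
  define ub where "ub v = Max (X v)" for v
  have ub: "X v \<subseteq> {real_of_int (l v)..ub v}" "real_of_int (l v) < ub v" "ub v < real_of_int (r v) + 1"
    if "v < n" for v
  proof -
    have "ub v \<in> X v" unfolding ub_def using card[OF that] rX by (intro Max_in) auto
    then show "ub v < real_of_int (r v) + 1" using Y lr[OF that] by (auto simp: X_def)
    have "real_of_int (r v) \<le> ub v" unfolding ub_def using card[OF that] rX by auto
    then show "real_of_int (l v) < ub v" using lr[OF that] by linarith
    show "X v \<subseteq> {real_of_int (l v)..ub v}"
      using card[OF that] Y lr[OF that] by (fastforce simp: ub_def X_def)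
  qed
  have sep: "\<not> meets (X u) (X v) \<and> \<not> meets (X v) (X u)"
    if uv: "u < n" "v < n" and "r u < l v \<or> l v < l u \<and> r u < r v" for u v
  proof -
    have "X v \<inter> {real_of_int (l u)..ub u} = {}"
    proof -
      have "x < real_of_int (l u) \<or> ub u < x" if x: "x \<in> X v" for x
      proof (cases "x = real_of_int (l v)")
        case True
        then show ?thesis using \<open>r u < l v \<or> _\<close> int_step[of "r u" "l v"] ub(3)[OF uv(1)] by auto
      next
        case False
        then have "real_of_int (r v) \<le> x" using x Y by (auto simp: X_def)
        moreover have "r u < r v" using \<open>r u < l v \<or> _\<close> lr[OF uv(2)] by auto
        ultimately show ?thesis using int_step[of "r u" "r v"] ub(3)[OF uv(1)] by auto
      qed
      then show ?thesis by fastforce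
    qed
    then show ?thesis using meets_separated[OF ub(2)[OF uv(1)] ub(1)[OF uv(1)]] by blast
  qed
  have cross: "meets (X u) (X v) \<and> meets (X v) (X u)"
    if "l u < l v \<and> l v < r u \<and> r u < r v" for u v
    using meets_interleaved[OF lX[of u] rX[of u] lX[of v] rX[of v]] that by auto
  have "E u v \<longleftrightarrow> meets (X u) (X v)" if uv: "u < n" "v < n" "u \<noteq> v" for u v
  proof (cases "E u v")
    case True
    then show ?thesis using cross[of u v] cross[of v u] E[OF uv] by auto
  next
    case False
    \<comment> \<open>Intervals with distinct endpoints that do not overlap are disjoint or
      nested.\<close>
    have "r u < l v \<or> l v < l u \<and> r u < r v \<or> r v < l u \<or> l u < l v \<and> r v < r u"
      using False E[OF uv] dist[OF uv] dist[OF uv(2,1)] uv(3) lr[OF uv(1)] lr[OF uv(2)] by linarith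
    then show ?thesis using sep[of u v] sep[of v u] uv False by blast
  qed
  then show ?thesis
    unfolding polygon_circle_graph_inscribed using card by (auto simp: meets_def)
qed

lemma ladder_polygon_circle_graph:
  assumes wm: "w \<le> m" and "inj p" and "k \<ge> 2"
  shows "polygon_circle_graph k (m + 2 * w) (ladder w m p p)"
proof -
  \<comment> \<open>The \<open>a\<^sub>i\<close> are nested around 0; the \<open>c\<^sub>u\<close> sit on the positive and the \<open>d\<^sub>i\<close> on the
    negative axis, each around one endpoint of \<open>a\<^sub>i\<close> and overlapping only its path neighbours.\<close>
  define l r :: "nat \<Rightarrow> int" where
    "l v = (if v < m then 10 * int (p v) + 1 else if v < m + w then - (10 * int (p (v - m)) + 6)
            else - (10 * int (p (v - m - w)) + 13))" and
    "r v = (if v < m then 10 * int (p v) + 13 else if v < m + w then 10 * int (p (v - m)) + 6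
            else - (10 * int (p (v - m - w)) + 1))" for v
  have inj: "p i = p j \<longleftrightarrow> i = j" for i j using \<open>inj p\<close> by (rule inj_eq)
  have lr_c: "l v = 10 * int (p v) + 1" "r v = 10 * int (p v) + 13" if "v < m" for v
    using that by (auto simp: l_def r_def)
  have lr_a: "l (m + i) = - (10 * int (p i) + 6)" "r (m + i) = 10 * int (p i) + 6" if "i < w" for i
    using that by (auto simp: l_def r_def)
  have lr_d: "l (m + w + i) = - (10 * int (p i) + 13)" "r (m + w + i) = - (10 * int (p i) + 1)" for i
    by (auto simp: l_def r_def)
  define cr where "cr u v \<longleftrightarrow> l u < l v \<and> l v < r u \<and> r u < r v \<or> l v < l u \<and> l u < r v \<and> r v < r u" for u v
  have cr_commute: "cr u v \<longleftrightarrow> cr v u" for u v by (auto simp: cr_def)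
  define ok where "ok u v \<longleftrightarrow> (l u \<noteq> l v \<and> r u \<noteq> r v \<and> l u \<noteq> r v \<and> r u \<noteq> l v) \<and> (ladder w m p p u v \<longleftrightarrow> cr u v)" for u v
  have ok_commute: "ok u v \<longleftrightarrow> ok v u" for u v
    by (auto simp: ok_def cr_commute ladder_commute)
  \<comment> \<open>Spacing 10 and length 12 make intervals of consecutive ranks overlap and those
    of ranks further apart disjoint. The offset 6 of a rung falls between 3 and 11, where only the
    interval of its own rank lies; the residues 1, 3 and 6 keep endpoints distinct.\<close>
  have cc: "ok u v" if "u < m" "v < m" "u \<noteq> v" for u v
    using that inj[of u v] unfolding ok_def cr_def ladder_cc[OF wm that(1,2)] lr_c[OF that(1)] lr_c[OF that(2)]
    by (cases "p u" "p v" rule: linorder_cases) (auto, presburger+)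
  have ac: "ok (m + i) v" if "i < w" "v < m" for i v
    using inj[of v i] unfolding ok_def cr_def ladder_ac[OF wm that] lr_a[OF that(1)] lr_c[OF that(2)]
    by (cases "p v" "p i" rule: linorder_cases) auto
  have cd: "ok v (m + w + i)" if "v < m" "i < w" for i v
    using ladder_cd[OF wm that, of p p] unfolding ok_def cr_def lr_c[OF that(1)] lr_d by auto
  have aa: "ok (m + i) (m + j)" if "i < w" "j < w" "i \<noteq> j" for i j
    using ladder_aa[OF wm that(1,2), of p p] that inj[of i j]
    unfolding ok_def cr_def lr_a[OF that(1)] lr_a[OF that(2)]
    by (cases "p i" "p j" rule: linorder_cases) auto
  have ad: "ok (m + i) (m + w + j)" if "i < w" "j < w" for i j
    using inj[of j i] unfolding ok_def cr_def ladder_ad[OF wm that] lr_a[OF that(1)] lr_d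
    by (cases "p j" "p i" rule: linorder_cases) auto
  have dd: "ok (m + w + i) (m + w + j)" if "i < w" "j < w" "i \<noteq> j" for i j
    using that inj[of i j] unfolding ok_def cr_def ladder_dd[OF wm that(1,2)] lr_d
    by (cases "p i" "p j" rule: linorder_cases) (auto, presburger+)
  have ok: "ok u v" if "u < m + 2 * w" "v < m + 2 * w" "u \<noteq> v" for u v
    using that(1)
  proof (cases rule: ladder_cases)
    case c
    from that(2) show ?thesis
      by (cases rule: ladder_cases) (use c that(3) cc ac cd ok_commute in auto)
  next
    case (a i)
    from that(2) show ?thesis
      by (cases rule: ladder_cases) (use a that(3) ac aa ad in auto)
  next
    case (d i)
    from that(2) show ?thesis
    proof (cases rule: ladder_cases)
      case c
      then show ?thesis using d cd ok_commute by auto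
    next
      case (a j)
      then show ?thesis using d ad ok_commute by auto
    next
      case (d j)
      then show ?thesis using \<open>u = m + w + i\<close> \<open>i < w\<close> dd that(3) by auto
    qed
  qed
  show ?thesis
  proof (rule polygon_circle_graph_intervals[OF \<open>k \<ge> 2\<close>, where l = l and r = r])
    show "l v < r v" if "v < m + 2 * w" for v
      using that by (cases rule: ladder_cases) (auto simp: lr_c lr_a lr_d)
    show "l u \<noteq> l v \<and> r u \<noteq> r v \<and> l u \<noteq> r v" if "u < m + 2 * w" "v < m + 2 * w" "u \<noteq> v" for u v
      using ok[OF that] by (auto simp: ok_def)
    show "ladder w m p p u v \<longleftrightarrow> l u < l v \<and> l v < r u \<and> r u < r v \<or> l v < l u \<and> l u < r v \<and> r v < r u"
      if "u < m + 2 * w" "v < m + 2 * w" "u \<noteq> v" for u v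
      using ok[OF that] by (auto simp: ok_def cr_def)
  qed
qed

section \<open>The lower bound\<close>

lemma card_bool_lists_length_le: "card {xs :: bool list. length xs \<le> F} \<le> 2 ^ Suc F"
proof -
  have "card {xs :: bool list. length xs \<le> F} = (\<Sum>i\<le>F. 2 ^ i)"
    using card_lists_length_le[of "UNIV :: bool set" F] by simp
  also have "(\<Sum>i\<le>F. 2 ^ i) \<le> (2::nat) ^ Suc F" by (induction F) auto
  finally show ?thesis .
qed

lemma pls_fooling_set:
  assumes pls: "is_pls c (polygon_circle_graph k) A f" and "c \<ge> 1" "k \<ge> 2"
    and wm: "w \<le> m" and w: "w \<ge> 1"
  shows "fact (w - 1) \<le> (2::nat) ^ (2 * w * Suc (f (m + 2 * w)))"
proof -
  define n where "n = m + 2 * w"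
  define Perms where "Perms = {p. p permutes {1..<w}}"
  have n1: "n \<ge> 1" using w by (simp add: n_def)
  have "n ^ 1 \<le> n ^ c" using n1 \<open>c \<ge> 1\<close> by (intro power_increasing) auto
  then have ids: "valid_ids c n Suc" unfolding valid_ids_def by auto
  have graph: "simple_graph n (ladder w m p q)" "connected_graph n (ladder w m p q)" if "p \<in> Perms" for p q
    using simple_graph_ladder[OF wm] connected_graph_ladder[OF wm] that by (auto simp: n_def Perms_def)
  have "\<exists>cert. (\<forall>v<n. length (cert v) \<le> f n) \<and> (\<forall>v<n. accepts_at A (ladder w m p p) Suc cert v)"
    if "p \<in> Perms" for p
  proof -
    have "polygon_circle_graph k n (ladder w m p p)"
      using ladder_polygon_circle_graph[OF wm _ \<open>k \<ge> 2\<close>] that permutes_inj by (auto simp: n_def Perms_def)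
    then show ?thesis using pls graph[OF that] ids n1 unfolding is_pls_def by blast
  qed
  then obtain cert where len: "\<And>p v. p \<in> Perms \<Longrightarrow> v < n \<Longrightarrow> length (cert p v) \<le> f n"
    and acc: "\<And>p v. p \<in> Perms \<Longrightarrow> v < n \<Longrightarrow> accepts_at A (ladder w m p p) Suc (cert p) v"
    by metis
  \<comment> \<open>Only the \<open>2 * w\<close> vertices of \<open>a\<close> and \<open>d\<close>
    are recorded, so the count does not grow with the length \<open>m\<close> of the first
    path.\<close>
  define colour where "colour p = restrict (cert p) {m..<n}" for p
  have "inj_on colour Perms"
  proof (rule inj_onI, rule ccontr)
    fix p q assume pq: "p \<in> Perms" "q \<in> Perms" "p \<noteq> q" and col: "colour p = colour q"
    have same: "cert p v = cert q v" if "m \<le> v" "v < n" for v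
      using fun_cong[OF col, of v] that by (simp add: colour_def)
    have "\<not> polygon_circle_graph k n (ladder w m p q)"
      using ladder_not_polygon_circle_graph[OF wm _ _ pq(3) \<open>k \<ge> 2\<close>] pq by (auto simp: n_def Perms_def)
    then obtain v where v: "v < n" "\<not> accepts_at A (ladder w m p q) Suc (cert p) v"
      using pls graph[OF pq(1)] ids n1 unfolding is_pls_def by blast
    show False
    proof (cases "v < m + w")
      case True
      \<comment> \<open>The neighbourhoods of the \<open>c\<close> and \<open>a\<close> vertices do
        not depend on the second permutation.\<close>
      then have "ladder w m p q v = ladder w m p p v"
        using wm by (intro ext) (auto simp: ladder_def ladder_arc_def)
      then show False using v acc[OF pq(1) v(1)] by (simp add: accepts_at_def)
    next
      case False
      then have eq: "ladder w m p q v = ladder w m q q v"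
        using wm by (intro ext) (auto simp: ladder_def ladder_arc_def)
      \<comment> \<open>A \<open>d\<close> vertex has only \<open>a\<close> and \<open>d\<close>
        neighbours, where the two certificate assignments agree.\<close>
      have "m \<le> u \<and> u < n" if "ladder w m q q v u" for u
        using that False wm by (auto simp: ladder_def ladder_arc_def n_def)
      then have "{(Suc u, cert p u) |u. ladder w m q q v u} = {(Suc u, cert q u) |u. ladder w m q q v u}"
        using same by (metis (no_types, lifting))
      then show False using v acc[OF pq(2) v(1)] same[of v] False eq by (simp add: accepts_at_def)
    qed
  qed
  moreover have "colour ` Perms \<subseteq> {m..<n} \<rightarrow>\<^sub>E {xs. length xs \<le> f n}"
    using len by (auto simp: colour_def)
  moreover have fin: "finite {xs :: bool list. length xs \<le> f n}"
    using finite_lists_length_le[of "UNIV :: bool set" "f n"] by simp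
  ultimately have "card Perms \<le> card ({m..<n} \<rightarrow>\<^sub>E {xs :: bool list. length xs \<le> f n})"
    by (intro card_inj_on_le finite_PiE) auto
  also have "\<dots> = card {xs :: bool list. length xs \<le> f n} ^ (2 * w)"
    by (simp add: card_PiE n_def)
  also have "\<dots> \<le> (2 ^ Suc (f n)) ^ (2 * w)"
    by (intro power_mono card_bool_lists_length_le) simp
  also have "\<dots> = 2 ^ (2 * w * Suc (f n))" by (simp only: power_mult[symmetric] mult.commute)
  finally show ?thesis
    unfolding Perms_def by (simp add: card_permutations[OF refl] n_def)
qed

section \<open>From the counting bound to the logarithm\<close>

text \<open>One term of the exponential series; at \<open>x = n\<close> it replaces Stirling's
  formula.\<close>

lemma power_over_fact_le_exp:
  fixes x :: real
  assumes "x \<ge> 0"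
  shows "x ^ n / fact n \<le> exp x"
proof -
  have "sum (\<lambda>k. x ^ k /\<^sub>R fact k) {n} \<le> (\<Sum>k. x ^ k /\<^sub>R fact k)"
    by (rule sum_le_suminf[OF summable_exp_generic]) (use assms in auto)
  then show ?thesis by (simp add: exp_def divide_inverse mult.commute)
qed

lemma pls_size_lower_bound:
  assumes pls: "is_pls c (polygon_circle_graph k) A f" and "c \<ge> 1" "k \<ge> 2"
  shows "\<exists>C>0. \<exists>N. \<forall>n\<ge>N. real (f n) \<ge> C * ln (real n)"
proof -
  \<comment> \<open>The estimate below ends in \<open>ln n \<le> 4 * F + 8\<close>. From
    \<open>exp 16\<close> on, 8 is at most half of \<open>ln n\<close>, which leaves the constant
    1/8.\<close>
  have "real (f n) \<ge> 1 / 8 * ln (real n)" if "n \<ge> nat \<lceil>exp (16::real)\<rceil>" for n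
  proof -
    have n: "real n \<ge> exp 16" using that by linarith
    moreover have "exp 16 \<ge> (17::real)" using exp_ge_add_one_self[of 16] by simp
    ultimately have "n \<ge> 17" by linarith
    define w where "w = n div 3"
    define N where "N = w - 1"
    define F where "F = real (f n)"
    have w: "w \<ge> 2" "w = Suc N" "N \<ge> 1" "n \<le> 4 * N + 3" using \<open>n \<ge> 17\<close> by (auto simp: w_def N_def)
    have "fact N \<le> (2::nat) ^ (2 * w * Suc (f (n - 2 * w + 2 * w)))"
      unfolding N_def by (rule pls_fooling_set[OF assms]) (use w in \<open>auto simp: w_def\<close>)
    moreover have "n - 2 * w + 2 * w = n" by (simp add: w_def)
    ultimately have "fact N \<le> (2::nat) ^ (2 * w * Suc (f n))" by simp
    then have fact_le: "fact N \<le> (2::real) ^ (2 * w * Suc (f n))"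
      by (metis of_nat_fact of_nat_le_iff of_nat_numeral of_nat_power)
    have N: "real N > 0" using w by simp
    have "real N * ln (real N) = ln (real N ^ N)" using N by (simp add: ln_realpow)
    also have "\<dots> \<le> ln (fact N * exp (real N))"
      using power_over_fact_le_exp[of "real N" N] N
      by (subst ln_le_cancel_iff) (auto simp: field_simps)
    also have "\<dots> = ln (fact N) + real N" by (simp add: ln_mult)
    also have "ln (fact N :: real) \<le> ln ((2::real) ^ (2 * w * Suc (f n)))"
      using fact_le by (subst ln_le_cancel_iff) auto
    also have "\<dots> = (2 * w * (F + 1)) * ln 2" by (simp add: ln_realpow F_def algebra_simps)
    also have "\<dots> \<le> (2 * w * (F + 1)) * 1"
      using ln_le_minus_one[of "2::real"] by (intro mult_left_mono) (auto simp: F_def)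
    \<comment> \<open>Here \<open>w = N + 1 \<le> 2 * N\<close>.\<close>
    also have "\<dots> \<le> 4 * N * (F + 1)"
      using w by (auto simp: F_def intro!: mult_right_mono)
    finally have "real N * ln (real N) \<le> real N * (4 * (F + 1) + 1)" by (simp add: algebra_simps)
    then have lnN: "ln (real N) \<le> 4 * F + 5" using N by simp
    have "real n \<le> 8 * real N" using w by linarith
    then have "ln (real n) \<le> ln (8 * real N)" using \<open>n \<ge> 17\<close> by (subst ln_le_cancel_iff) auto
    also have "\<dots> = ln 8 + ln (real N)" using N by (simp add: ln_mult)
    also have "ln (8::real) = 3 * ln 2" using ln_realpow[of "2::real" 3] by simp
    finally have "ln (real n) \<le> 4 * F + 8" using lnN ln_le_minus_one[of "2::real"] by linarith
    moreover have "16 \<le> ln (real n)" using n \<open>n \<ge> 17\<close> by (subst ln_ge_iff) auto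
    ultimately show ?thesis unfolding F_def by linarith
  qed
  then show ?thesis by (intro exI[of _ "1 / 8 :: real"] conjI exI[of _ "nat \<lceil>exp (16::real)\<rceil>"]) auto
qed

theorem theorem6:
  fixes c k :: nat
  assumes "c \<ge> 1" and "k \<ge> 3"
  shows "(\<forall>A f. is_pls c circle_graph A f \<longrightarrow>
            (\<exists>C>0. \<exists>N. \<forall>n\<ge>N. real (f n) \<ge> C * ln (real n))) \<and>
         (\<forall>A f. is_pls c (polygon_circle_graph k) A f \<longrightarrow>
            (\<exists>C>0. \<exists>N. \<forall>n\<ge>N. real (f n) \<ge> C * ln (real n)))"
  unfolding circle_graph_eq_2_polygon
  using assms by (auto intro!: pls_size_lower_bound)

end
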